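(* Let $1\le k\le n-1$ and let $w\in\mathfrak{S}_n$ be the permutation $(w(1),\dots,w(n))=(n-k+1,n-k+2,\dots,n,1,2,\dots,n-k)$, which is the maximal element of the set $A_{n-1}^{S\setminus\{s_k\}}$ of minimal left coset representatives of $\mathfrak{S}_n$ modulo the parabolic subgroup generated by $S\setminus\{s_k\}$. Then the Poincaré polynomial of the Bruhat interval $[\mathrm{id},w]$ is \[P_{[\mathrm{id},w]}(q)=q^{(n-k)k}\sum_{i=0}^{k}S_{k+1,i+1}(1/q)\,S_{n-k+1,i+1}(1/q)\,[i]!_q^2\,q^{i}.\]
   Context: $A_{n-1}$ is the symmetric group $\mathfrak{S}_n$ with Coxeter generators $S=\{s_1,\dots,s_{n-1}\}$, $s_i$ the adjacent transposition $(i\ i{+}1)$; Bruhat order and length $\ell$ (number of inversions) are the usual ones. $P_{[u,w]}(q)=\sum_{v\in[u,w]}q^{\ell(v)}$. $[x]_q=1+q+\dots+q^{x-1}$ and $[i]!_q=[1]_q[2]_q\cdots[i]_q$ (with $[0]!_q=1$). The $q$-Stirling numbers $S_{n,k}(q)$ are defined by $S_{0,0}(q)=1$, $S_{n,k}(q)=0$ for $k<0$ or $k>n$, and $S_{n+1,k}(q)=q^{k-1}S_{n,k-1}(q)+[k]_qS_{n,k}(q)$. *)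

theory Defs
  imports "HOL-Algebra.Sym_Groups" "HOL-Computational_Algebra.Computational_Algebra"
begin

definition adj_transp :: "nat \<Rightarrow> nat \<Rightarrow> nat" where
  "adj_transp i = Transposition.transpose i (i + 1)"

definition perm_length :: "nat \<Rightarrow> (nat \<Rightarrow> nat) \<Rightarrow> nat" where
  "perm_length n v = card {(i, j). i \<in> {1..n} \<and> j \<in> {1..n} \<and> i < j \<and> v i > v j}"

text \<open>Bruhat order: generated by \<open>u < u t\<close> for a reflection \<open>t\<close> with \<open>\<ell>(u) < \<ell>(u t)\<close>. The
  reflections of the symmetric group (conjugates of the Coxeter generators) are the transpositions.\<close>

definition bruhat_step :: "nat \<Rightarrow> (nat \<Rightarrow> nat) \<Rightarrow> (nat \<Rightarrow> nat) \<Rightarrow> bool" where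
  "bruhat_step n u v \<longleftrightarrow>
     (\<exists>i\<in>{1..n}. \<exists>j\<in>{1..n}. i < j \<and> v = u \<circ> Transposition.transpose i j \<and>
        perm_length n u < perm_length n v)"

definition bruhat_le :: "nat \<Rightarrow> (nat \<Rightarrow> nat) \<Rightarrow> (nat \<Rightarrow> nat) \<Rightarrow> bool" where
  "bruhat_le n = (bruhat_step n)\<^sup>*\<^sup>*"

definition bruhat_interval :: "nat \<Rightarrow> (nat \<Rightarrow> nat) \<Rightarrow> (nat \<Rightarrow> nat) \<Rightarrow> (nat \<Rightarrow> nat) set" where
  "bruhat_interval n u w = {v \<in> carrier (sym_group n). bruhat_le n u v \<and> bruhat_le n v w}"

definition poincare_poly :: "nat \<Rightarrow> (nat \<Rightarrow> nat) \<Rightarrow> (nat \<Rightarrow> nat) \<Rightarrow> int poly" where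
  "poincare_poly n u w = (\<Sum>v\<in>bruhat_interval n u w. monom 1 (perm_length n v))"

text \<open>Elements of minimal length in their left coset modulo the parabolic subgroup generated by
  \<open>J\<close>.\<close>

definition min_left_coset_reps :: "nat \<Rightarrow> (nat \<Rightarrow> nat) set \<Rightarrow> (nat \<Rightarrow> nat) set" where
  "min_left_coset_reps n J =
     {v \<in> carrier (sym_group n).
        \<forall>u \<in> v <#\<^bsub>sym_group n\<^esub> generate (sym_group n) J. perm_length n v \<le> perm_length n u}"

definition q_int :: "'a::comm_semiring_1 \<Rightarrow> nat \<Rightarrow> 'a" where
  "q_int q x = (\<Sum>j<x. q ^ j)"

definition q_fact :: "'a::comm_semiring_1 \<Rightarrow> nat \<Rightarrow> 'a" where
  "q_fact q i = (\<Prod>j=1..i. q_int q j)"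

text \<open>\<open>q_stirling q n k\<close> is \<open>S\<^bsub>n,k\<^esub>(q)\<close>. For \<open>k = 0\<close> the right-hand side of the recurrence
  vanishes, as \<open>S\<^bsub>n,-1\<^esub> = 0\<close> and \<open>[0]\<^sub>q = 0\<close>; the values for \<open>k > n\<close> are \<open>0\<close> by the recurrence.\<close>

fun q_stirling :: "'a::comm_semiring_1 \<Rightarrow> nat \<Rightarrow> nat \<Rightarrow> 'a" where
  "q_stirling q 0 0 = 1"
| "q_stirling q 0 (Suc k) = 0"
| "q_stirling q (Suc n) 0 = 0"
| "q_stirling q (Suc n) (Suc k) = q ^ k * q_stirling q n k + q_int q (Suc k) * q_stirling q n (Suc k)"

end

theory Submission
  imports Defs
begin

text \<open>
  The interval \<open>[id, w]\<close> consists of the permutations \<open>v\<close> in the band \<open>i - k \<le> v i \<le> i + (n - k)\<close>: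
  the band is closed under going down, and every element of it other than \<open>w\<close> can be raised
  inside it.

  Let \<open>m = n - k\<close>, let \<open>A\<close> be the set of values of \<open>v\<close> at the positions \<open>\<le> k\<close>, and put
  \<open>D = A \<inter> {1..m}\<close>; let \<open>E\<close> be the reflection \<open>x \<mapsto> n + 1 - x\<close> of the values \<open>> m\<close> missing from \<open>A\<close>.
  Then \<open>|D| = |E| = i\<close>. For fixed \<open>A\<close> the two halves of \<open>v\<close> are words with increasing upper
  bounds (after reflecting the second half), whose inversion generating function is a product of
  \<open>q\<close>-integers. The sum over \<open>A\<close> thereby splits as \<open>\<Sum>i. q^((k-i)(m-i)) F(m,i) F(k,i)\<close>, where \<open>F(m,i)\<close> sums
  a weight over the \<open>i\<close>-subsets of \<open>{1..m}\<close>. Removing the largest element gives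
  \<open>F(m+1,i+1) = [i+2] F(m,i+1) + q^(m-i) [i+1] F(m,i)\<close>, hence
  \<open>F(m,i) = [i]! q^(im - i(i-1)/2) S\<^bsub>m+1,i+1\<^esub>(1/q)\<close>.
\<close>

section \<open>Inversions of words\<close>

text \<open>Smaller later letters are counted as a set, so this is the inversion number for distinct
  words, to which it is applied throughout.\<close>

fun list_inv :: "nat list \<Rightarrow> nat" where
  "list_inv [] = 0"
| "list_inv (x # xs) = card {y \<in> set xs. y < x} + list_inv xs"

lemma list_inv_map_upt:
  assumes "inj_on v {a..<b}"
  shows "list_inv (map v [a..<b]) =
    card {(i, j). i \<in> {a..<b} \<and> j \<in> {a..<b} \<and> i < j \<and> v j < v i}"
  using assms
proof (induction "b - a" arbitrary: a)
  case 0
  then have "{(i, j). i \<in> {a..<b} \<and> j \<in> {a..<b} \<and> i < j \<and> v j < v i} = {}" by auto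
  with 0 show ?case by (simp only: card.empty) simp
next
  case (Suc d)
  then have ab: "a < b" by simp
  let ?I = "\<lambda>a. {(i, j). i \<in> {a..<b} \<and> j \<in> {a..<b} \<and> i < j \<and> v j < v i}"
  let ?J = "{j \<in> {Suc a..<b}. v j < v a}"
  have inj: "inj_on v {Suc a..<b}" by (rule inj_on_subset[OF Suc.prems]) auto
  have IH: "list_inv (map v [Suc a..<b]) = card (?I (Suc a))"
    using Suc.hyps(1)[of "Suc a"] Suc.hyps(2) inj by simp
  have fin: "finite (?I (Suc a))"
    by (rule finite_subset[of _ "{a..<b} \<times> {a..<b}"]) auto
  have atLeastLessThan_insert: "{a..<b} = insert a {Suc a..<b}" using ab by auto
  have split: "?I a = Pair a ` ?J \<union> ?I (Suc a)"
    unfolding atLeastLessThan_insert by auto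
  have "card (?I a) = card (Pair a ` ?J) + card (?I (Suc a))"
    by (subst split, rule card_Un_disjoint) (use fin in auto)
  moreover have "card (Pair a ` ?J) = card ?J"
    by (rule card_image) (auto simp: inj_on_def)
  moreover have "{y \<in> set (map v [Suc a..<b]). y < v a} = v ` ?J" by auto
  moreover have "card (v ` ?J) = card ?J"
    by (rule card_image, rule inj_on_subset[OF inj]) auto
  ultimately show ?case
    using IH ab by (simp add: upt_conv_Cons del: upt_Suc)
qed

lemma perm_length_eq_list_inv:
  assumes "inj_on v {1..n}"
  shows "perm_length n v = list_inv (map v [1..<n + 1])"
proof -
  have "{1..n} = {1..<n + 1}" by auto
  with assms show ?thesis
    using list_inv_map_upt[of v 1 "n + 1"] by (simp add: perm_length_def)
qed

lemma list_inv_append: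
  assumes "distinct (xs @ ys)"
  shows "list_inv (xs @ ys) = list_inv xs + list_inv ys +
    card {(x, y). x \<in> set xs \<and> y \<in> set ys \<and> y < x}"
  using assms
proof (induction xs)
  case (Cons x xs)
  let ?C = "\<lambda>zs. {(x, y). x \<in> set zs \<and> y \<in> set ys \<and> y < x}"
  have fin: "finite (?C xs)"
    by (rule finite_subset[of _ "set xs \<times> set ys"]) auto
  have split: "?C (x # xs) = Pair x ` {y \<in> set ys. y < x} \<union> ?C xs" by auto
  have "card (?C (x # xs)) = card (Pair x ` {y \<in> set ys. y < x}) + card (?C xs)"
    by (subst split, rule card_Un_disjoint) (use fin Cons.prems in auto)
  also have "card (Pair x ` {y \<in> set ys. y < x}) = card {y \<in> set ys. y < x}"
    by (rule card_image) (auto simp: inj_on_def)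
  finally have C: "card (?C (x # xs)) = card {y \<in> set ys. y < x} + card (?C xs)" .
  have split: "{y \<in> set (xs @ ys). y < x} = {y \<in> set xs. y < x} \<union> {y \<in> set ys. y < x}" by auto
  have "card {y \<in> set (xs @ ys). y < x} = card {y \<in> set xs. y < x} + card {y \<in> set ys. y < x}"
    by (subst split, rule card_Un_disjoint) (use Cons.prems in auto)
  with C Cons show ?case by simp
qed simp

text \<open>Reversing positions and reversing values each exchange inversions with non-inversions,
  so together they preserve the count. This later turns lower bounds on a word into upper
  bounds.\<close>

lemma list_inv_rev_reflect:
  assumes "distinct xs" "set xs \<subseteq> {..N}"
  shows "list_inv (rev (map (\<lambda>x. N - x) xs)) = list_inv xs"
  using assms
proof (induction xs)
  case (Cons x xs)
  let ?r = "\<lambda>x. N - x"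
  have inj: "inj_on ?r (set (x # xs))"
    by (rule inj_on_subset[of _ "{..N}"]) (use Cons.prems in \<open>auto simp: inj_on_def\<close>)
  have d: "distinct (rev (map ?r xs) @ [?r x])"
    using Cons.prems inj by (auto simp: distinct_map inj_on_def)
  have "{(a, b). a \<in> set (rev (map ?r xs)) \<and> b \<in> set [?r x] \<and> b < a} =
      (\<lambda>y. (?r y, ?r x)) ` {y \<in> set xs. y < x}"
    using Cons.prems by auto
  moreover have "card ((\<lambda>y. (?r y, ?r x)) ` {y \<in> set xs. y < x}) = card {y \<in> set xs. y < x}"
    by (rule card_image) (use inj in \<open>auto simp: inj_on_def\<close>)
  ultimately have c: "card {(a, b). a \<in> set (rev (map ?r xs)) \<and> b \<in> set [?r x] \<and> b < a} =
      card {y \<in> set xs. y < x}" by simp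
  show ?case
    using list_inv_append[OF d] c Cons by simp
qed simp

section \<open>Words with increasing upper bounds\<close>

definition bounded_words :: "nat \<Rightarrow> nat \<Rightarrow> nat set \<Rightarrow> nat list set" where
  "bounded_words c l A =
     {ys. distinct ys \<and> set ys = A \<and> length ys = l \<and> (\<forall>j<l. ys ! j \<le> c + j)}"

lemma finite_bounded_words: "finite A \<Longrightarrow> finite (bounded_words c l A)"
  by (rule finite_subset[OF _ finite_lists_length_eq[of A l]]) (auto simp: bounded_words_def)

lemma sum_power_rank:
  assumes "finite (B :: nat set)"
  shows "(\<Sum>x\<in>B. q ^ card {y \<in> B. y < x}) = q_int q (card B)"
  using assms
proof (induction B rule: finite_linorder_max_induct)
  case (insert b B)
  have "{y \<in> insert b B. y < b} = B" using insert by auto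
  moreover have "{y \<in> insert b B. y < x} = {y \<in> B. y < x}" if "x \<in> B" for x
    using that insert by auto
  moreover have "b \<notin> B" using insert by auto
  ultimately show ?case using insert by (simp add: q_int_def add.commute)
qed (simp add: q_int_def)

lemma bounded_words_Suc:
  "ys \<in> bounded_words c (Suc l) A \<longleftrightarrow>
    (\<exists>x us. ys = x # us \<and> x \<in> A \<and> x \<le> c \<and> us \<in> bounded_words (Suc c) l (A - {x}))"
proof (cases ys)
  case (Cons x us)
  have "(\<forall>j<Suc l. (x # us) ! j \<le> c + j) \<longleftrightarrow> x \<le> c \<and> (\<forall>j<l. us ! j \<le> Suc c + j)"
    by (simp add: All_less_Suc2)
  then show ?thesis
    using Cons by (auto simp: bounded_words_def)
qed (simp add: bounded_words_def)

text \<open>Choose letters from left to right. The bounds increase, so the \<open>j\<close> letters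
  already placed lie under the bound at place \<open>j\<close> and leave
  \<open>card (A \<inter> {..c + j}) - j\<close> choices; the choice of rank \<open>r\<close> costs
  \<open>r\<close> inversions with later letters. If the difference is \<open>0\<close>, the factor
  vanishes and no word exists.\<close>

lemma sum_bounded_words:
  assumes "finite A" "card A = l"
  shows "(\<Sum>ys\<in>bounded_words c l A. q ^ list_inv ys) =
    (\<Prod>j<l. q_int q (card (A \<inter> {..c + j}) - j))"
  using assms
proof (induction l arbitrary: c A)
  case 0
  then have "bounded_words c 0 A = {[]}" by (auto simp: bounded_words_def)
  then show ?case by simp
next
  case (Suc l)
  let ?B = "A \<inter> {..c}"
  let ?R = "\<Prod>j<l. q_int q (card (A \<inter> {..c + Suc j}) - Suc j)"
  have "(\<Sum>ys\<in>bounded_words c (Suc l) A. q ^ list_inv ys) =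
      (\<Sum>(x, us)\<in>(SIGMA x:?B. bounded_words (Suc c) l (A - {x})).
         q ^ (card {y \<in> ?B. y < x} + list_inv us))"
  proof (rule sum.reindex_bij_witness[of _ "\<lambda>(x, us). x # us" "\<lambda>ys. (hd ys, tl ys)"])
    fix ys assume "ys \<in> bounded_words c (Suc l) A"
    then obtain x us where ys: "ys = x # us" "x \<in> A" "x \<le> c" "us \<in> bounded_words (Suc c) l (A - {x})"
      by (auto simp: bounded_words_Suc)
    then have set_us: "set us = A - {x}" by (simp add: bounded_words_def)
    \<comment> \<open>A remaining letter below \<open>x\<close> also respects the bound
      \<open>c\<close>, so the rank of \<open>x\<close> in \<open>?B\<close> counts exactly the
      inversions starting at \<open>x\<close>.\<close>
    have "{y \<in> ?B. y < x} = {y \<in> set us. y < x}" unfolding set_us using ys(3) by auto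
    then show "(case (hd ys, tl ys) of (x, us) \<Rightarrow> q ^ (card {y \<in> ?B. y < x} + list_inv us)) =
        q ^ list_inv ys"
      using ys by simp
  qed (auto simp: bounded_words_Suc)
  also have "\<dots> = (\<Sum>x\<in>?B. \<Sum>us\<in>bounded_words (Suc c) l (A - {x}).
         q ^ (card {y \<in> ?B. y < x} + list_inv us))"
    using Suc.prems by (subst sum.Sigma) (auto intro: finite_bounded_words)
  also have "\<dots> = (\<Sum>x\<in>?B. q ^ card {y \<in> ?B. y < x} * ?R)"
  proof (rule sum.cong[OF refl])
    fix x assume x: "x \<in> ?B"
    have "card ((A - {x}) \<inter> {..Suc c + j}) - j = card (A \<inter> {..c + Suc j}) - Suc j" for j
    proof -
      have "(A - {x}) \<inter> {..Suc c + j} = (A \<inter> {..c + Suc j}) - {x}" by auto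
      moreover have "x \<in> A \<inter> {..c + Suc j}" using x by auto
      ultimately show ?thesis using Suc.prems by simp
    qed
    then show "(\<Sum>us\<in>bounded_words (Suc c) l (A - {x}). q ^ (card {y \<in> ?B. y < x} + list_inv us)) =
        q ^ card {y \<in> ?B. y < x} * ?R"
      using Suc.IH[of "A - {x}" "Suc c"] Suc.prems x
      by (simp add: power_add flip: sum_distrib_left)
  qed
  also have "\<dots> = q_int q (card ?B) * ?R"
    using Suc.prems by (simp only: sum_distrib_right[symmetric] sum_power_rank finite_Int simp_thms)
  also have "\<dots> = (\<Prod>j<Suc l. q_int q (card (A \<inter> {..c + j}) - j))"
    by (simp add: prod.lessThan_Suc_shift del: prod.lessThan_Suc)
  finally show ?case .
qed

section \<open>The subset sums and \<open>q\<close>-Stirling numbers\<close>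

definition subset_inv :: "nat \<Rightarrow> nat set \<Rightarrow> nat" where
  "subset_inv m D = card {(d, r). d \<in> D \<and> r \<in> {1..m} - D \<and> r < d}"

text \<open>The product is the inversion generating function of the half-word belonging to
  \<open>D\<close>; \<open>sum_bounded_words_glue\<close> makes this precise.\<close>

definition subset_weight :: "'a::comm_semiring_1 \<Rightarrow> nat \<Rightarrow> nat set \<Rightarrow> 'a" where
  "subset_weight q m D =
     q ^ subset_inv m D * (\<Prod>s=1..m. q_int q (card D + 1 - card (D \<inter> {s..m})))"

definition subset_gf :: "'a::comm_semiring_1 \<Rightarrow> nat \<Rightarrow> nat \<Rightarrow> 'a" where
  "subset_gf q m i = (\<Sum>D | D \<subseteq> {1..m} \<and> card D = i. subset_weight q m D)"

lemma subset_gf_eq_0: "m < i \<Longrightarrow> subset_gf q m i = 0"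
proof -
  assume "m < i"
  then have "{D. D \<subseteq> {1..m} \<and> card D = i} = {}"
    using card_mono[OF finite_atLeastAtMost, of _ 1 m] by (auto simp: not_le[symmetric])
  then show ?thesis unfolding subset_gf_def by (simp only: sum.empty)
qed

text \<open>The missing value \<open>Suc m\<close> exceeds all of \<open>D\<close>, so no pair is
  added; the new factor, at \<open>s = Suc m\<close>, has an empty intersection.\<close>

lemma subset_weight_Suc_notin:
  assumes "D \<subseteq> {1..m}"
  shows "subset_weight q (Suc m) D = q_int q (card D + 1) * subset_weight q m D"
proof -
  have le: "d \<le> m" if "d \<in> D" for d using assms that by auto
  have "{(d, r). d \<in> D \<and> r \<in> {1..Suc m} - D \<and> r < d} = {(d, r). d \<in> D \<and> r \<in> {1..m} - D \<and> r < d}"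
    by (auto dest: le)
  moreover have "D \<inter> {s..Suc m} = D \<inter> {s..m}" for s by (auto dest: le)
  moreover have "D \<inter> {Suc m..m} = {}" by auto
  ultimately show ?thesis by (simp add: subset_weight_def subset_inv_def ac_simps)
qed

text \<open>For \<open>s \<le> m\<close> the cardinality and the intersection count both grow by
  one, so the old factors survive. The new element exceeds each of the \<open>m - card D\<close>
  missing values.\<close>

lemma subset_weight_Suc_insert:
  assumes "D \<subseteq> {1..m}"
  shows "subset_weight q (Suc m) (insert (Suc m) D) =
    q ^ (m - card D) * q_int q (card D + 1) * subset_weight q m D"
proof -
  have fin: "finite D" using assms finite_subset by blast
  have notin: "Suc m \<notin> D" using assms by auto
  have le: "d \<le> m" if "d \<in> D" for d using assms that by auto
  let ?X = "{(d, r). d \<in> D \<and> r \<in> {1..m} - D \<and> r < d}"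
  have finX: "finite ?X"
    by (rule finite_subset[of _ "D \<times> {1..m}"]) (use fin in auto)
  have split: "{(d, r). d \<in> insert (Suc m) D \<and> r \<in> {1..Suc m} - insert (Suc m) D \<and> r < d} =
      Pair (Suc m) ` ({1..m} - D) \<union> ?X"
    by (auto dest: le)
  have "subset_inv (Suc m) (insert (Suc m) D) = card (Pair (Suc m) ` ({1..m} - D)) + card ?X"
    unfolding subset_inv_def by (subst split, rule card_Un_disjoint) (use finX notin in auto)
  also have "card (Pair (Suc m) ` ({1..m} - D)) = card ({1..m} - D)"
    by (rule card_image) (auto simp: inj_on_def)
  also have "\<dots> = m - card D" using assms fin by (simp add: card_Diff_subset)
  finally have inv: "subset_inv (Suc m) (insert (Suc m) D) = m - card D + subset_inv m D"
    by (simp add: subset_inv_def)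
  have c: "card (insert (Suc m) D \<inter> {s..Suc m}) = Suc (card (D \<inter> {s..m}))" if "s \<le> Suc m" for s
  proof -
    have "insert (Suc m) D \<inter> {s..Suc m} = insert (Suc m) (D \<inter> {s..m})"
      using that by (auto dest: le)
    then show ?thesis using fin notin by simp
  qed
  have "(\<Prod>s=1..m. q_int q (card (insert (Suc m) D) + 1 - card (insert (Suc m) D \<inter> {s..Suc m}))) =
      (\<Prod>s=1..m. q_int q (card D + 1 - card (D \<inter> {s..m})))"
    using fin notin c by (intro prod.cong) auto
  then show ?thesis
    using fin notin c[of "Suc m"] by (simp add: subset_weight_def inv power_add ac_simps)
qed

lemma Collect_subset_Suc:
  "{D. D \<subseteq> {1..Suc m} \<and> card D = Suc i} =
    {D. D \<subseteq> {1..m} \<and> card D = Suc i} \<union> insert (Suc m) ` {D. D \<subseteq> {1..m} \<and> card D = i}"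
    (is "?L = ?R")
proof (intro equalityI subsetI)
  fix D assume D: "D \<in> ?L"
  then have fin: "finite D" using finite_subset by blast
  show "D \<in> ?R"
  proof (cases "Suc m \<in> D")
    case True
    then have "D = insert (Suc m) (D - {Suc m})" by auto
    moreover have "D - {Suc m} \<subseteq> {1..m}" using D by (auto simp: le_Suc_eq)
    moreover have "card (D - {Suc m}) = i" using D True by simp
    ultimately show ?thesis by blast
  next
    case False
    then have "D \<subseteq> {1..m}" using D by (auto simp: subset_iff le_Suc_eq)
    then show ?thesis using D by auto
  qed
next
  fix D assume "D \<in> ?R"
  then consider "D \<subseteq> {1..m}" "card D = Suc i"
    | D' where "D = insert (Suc m) D'" "D' \<subseteq> {1..m}" "card D' = i" by auto
  then show "D \<in> ?L"
  proof cases
    case 2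
    then have "finite D'" "Suc m \<notin> D'" using finite_subset by auto
    with 2 show ?thesis by auto
  qed auto
qed

text \<open>Split the subsets by whether they contain \<open>Suc m\<close>. Truncation in
  \<open>m - i\<close> does no harm, as \<open>subset_gf q m i = 0\<close> for
  \<open>m < i\<close>.\<close>

lemma subset_gf_Suc_Suc:
  "subset_gf q (Suc m) (Suc i) =
    q_int q (i + 2) * subset_gf q m (Suc i) + q ^ (m - i) * q_int q (i + 1) * subset_gf q m i"
proof -
  have fin: "finite {D. D \<subseteq> {1..m} \<and> card D = i}" for i m :: nat
    by (rule finite_subset[of _ "Pow {1..m}"]) auto
  let ?S = "\<lambda>i. {D. D \<subseteq> {1..m} \<and> card D = i}"
  have split: "subset_gf q (Suc m) (Suc i) =
      (\<Sum>D\<in>?S (Suc i). subset_weight q (Suc m) D) +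
      (\<Sum>D\<in>insert (Suc m) ` ?S i. subset_weight q (Suc m) D)"
    unfolding subset_gf_def Collect_subset_Suc by (rule sum.union_disjoint) (use fin in auto)
  have notin: "Suc m \<notin> D" if "D \<in> ?S i" for D using that by auto
  have inj: "inj_on (insert (Suc m)) (?S i)"
    by (rule inj_onI) (simp add: insert_ident notin)
  note split
  also have "(\<Sum>D\<in>insert (Suc m) ` ?S i. subset_weight q (Suc m) D) =
      (\<Sum>D\<in>?S i. subset_weight q (Suc m) (insert (Suc m) D))"
    using inj by (simp add: sum.reindex)
  finally show ?thesis
    by (simp add: subset_gf_def sum_distrib_left subset_weight_Suc_notin subset_weight_Suc_insert
        mult.assoc)
qed

lemma Collect_subset_card_0: "{D. D \<subseteq> {1..m::nat} \<and> card D = 0} = {{}}"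
  by (auto dest: finite_subset)

lemma subset_gf_0_right: "subset_gf q m 0 = 1"
  unfolding subset_gf_def Collect_subset_card_0
  by (simp add: subset_weight_def subset_inv_def q_int_def)

section \<open>Passage to \<open>q\<close>-Stirling numbers at \<open>1 / q\<close>\<close>

text \<open>The coefficients of \<open>[i + 1]\<close> form a palindrome, so inverting
  \<open>q\<close> only shifts exponents by \<open>i\<close>.\<close>

lemma q_int_inverse:
  fixes q :: "'a::field"
  assumes "q \<noteq> 0"
  shows "q ^ i * q_int (1 / q) (Suc i) = q_int q (Suc i)"
proof -
  have "q ^ i * q_int (1 / q) (Suc i) = (\<Sum>j<Suc i. q ^ (i - j))"
    unfolding q_int_def sum_distrib_left
    using assms by (intro sum.cong) (auto simp: power_diff field_simps)
  also have "\<dots> = (\<Sum>j<Suc i. q ^ j)"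
    using sum.nat_diff_reindex[of "\<lambda>j. q ^ j" "Suc i"] by simp
  finally show ?thesis by (simp add: q_int_def)
qed

lemma q_stirling_Suc_1: "q_stirling q (Suc m) (Suc 0) = 1"
  by (induction m) (simp_all add: q_int_def)

text \<open>The factor \<open>q ^ (i choose 2)\<close> keeps all exponents natural numbers. After
  this rescaling \<open>subset_gf_Suc_Suc\<close> becomes the Stirling recurrence at
  \<open>1 / q\<close>.\<close>

lemma subset_gf_eq_q_stirling:
  fixes q :: "'a::field"
  assumes "q \<noteq> 0"
  shows "subset_gf q m i * q ^ (i choose 2) =
    q_fact q i * q ^ (i * m) * q_stirling (1 / q) (m + 1) (i + 1)"
proof (induction m arbitrary: i)
  case 0
  show ?case
    by (cases i) (simp_all add: subset_gf_0_right subset_gf_eq_0 q_fact_def q_int_def numeral_2_eq_2)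
next
  case (Suc m)
  show ?case
  proof (cases i)
    case 0
    then show ?thesis
      using q_stirling_Suc_1[of "1 / q" "Suc m"]
      by (simp add: subset_gf_0_right q_fact_def numeral_2_eq_2 del: q_stirling.simps)
  next
    case (Suc j)
    let ?S = "q_stirling (1 / q) (m + 1)"
    have choose: "Suc j choose 2 = (j choose 2) + j" by (simp add: numeral_2_eq_2)
    have fact: "q_fact q (Suc j) = q_int q (Suc j) * q_fact q j"
      by (simp add: q_fact_def mult.commute)
    \<comment> \<open>The extra \<open>j\<close> in \<open>Suc j choose 2\<close> completes
      \<open>q ^ (m - j)\<close> to \<open>q ^ m\<close>; for \<open>j > m\<close> both sides
      vanish.\<close>
    have A: "q ^ (m - j) * q_int q (j + 1) * subset_gf q m j * q ^ (Suc j choose 2) =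
        q_int q (j + 1) * q ^ m * (subset_gf q m j * q ^ (j choose 2))"
    proof (cases "j \<le> m")
      case True
      then have "q ^ m = q ^ (m - j) * q ^ j" by (simp flip: power_add)
      then show ?thesis by (simp add: choose power_add)
    qed (simp add: subset_gf_eq_0)
    have "subset_gf q (Suc m) i * q ^ (i choose 2) =
        q_int q (j + 2) * (subset_gf q m (Suc j) * q ^ (Suc j choose 2)) +
        q_int q (j + 1) * q ^ m * (subset_gf q m j * q ^ (j choose 2))"
      using A by (simp only: Suc subset_gf_Suc_Suc distrib_right) (simp only: mult.assoc)
    also have "\<dots> = q_int q (j + 2) * (q_fact q (Suc j) * q ^ (Suc j * m) * ?S (j + 2)) +
        q_int q (j + 1) * q ^ m * (q_fact q j * q ^ (j * m) * ?S (j + 1))"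
      by (simp only: Suc.IH) simp
    also have "\<dots> = q_fact q (Suc j) * q ^ (Suc j * m) * (q_int q (j + 2) * ?S (j + 2) + ?S (j + 1))"
      by (simp add: fact power_add algebra_simps del: q_stirling.simps)
    \<comment> \<open>Pulling out \<open>q ^ Suc j\<close> inverts \<open>q\<close> inside
      \<open>[j + 2]\<close> and produces the power of \<open>1 / q\<close> in the Stirling
      recurrence.\<close>
    also have "\<dots> = q_fact q (Suc j) * q ^ (Suc j * m) *
        (q ^ Suc j * (q_int (1 / q) (j + 2) * ?S (j + 2) + (1 / q) ^ Suc j * ?S (j + 1)))"
    proof -
      have "q ^ Suc j * (1 / q) ^ Suc j = 1"
        using assms by (simp only: power_mult_distrib[symmetric]) simp
      moreover have "q_int q (j + 2) = q ^ Suc j * q_int (1 / q) (j + 2)"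
        using q_int_inverse[OF assms, of "Suc j"] by simp
      ultimately show ?thesis
        by (simp only: distrib_left mult.assoc[symmetric] mult_1_left)
    qed
    also have "\<dots> = q_fact q i * q ^ (i * Suc m) * q_stirling (1 / q) (Suc m + 1) (i + 1)"
    proof -
      have "q_stirling (1 / q) (Suc m + 1) (i + 1) =
          (1 / q) ^ Suc j * ?S (j + 1) + q_int (1 / q) (j + 2) * ?S (j + 2)"
        by (simp only: Suc Suc_eq_plus1[symmetric] q_stirling.simps) simp
      moreover have "q ^ (i * Suc m) = q ^ (Suc j * m) * q ^ Suc j"
        by (simp only: Suc power_add[symmetric]) (simp add: algebra_simps)
      ultimately show ?thesis
        by (simp only: Suc) (simp only: mult.assoc add.commute)
    qed
    finally show ?thesis .
  qed
qed

section \<open>Splitting a set of values\<close>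

text \<open>\<open>glue m k D E\<close> is the set \<open>A\<close> belonging to \<open>(D, E)\<close>.\<close>

definition glue :: "nat \<Rightarrow> nat \<Rightarrow> nat set \<Rightarrow> nat set \<Rightarrow> nat set" where
  "glue m k D E = {x \<in> {1..m + k}. if x \<le> m then x \<in> D else m + k + 1 - x \<notin> E}"

lemma inj_on_reflect: "inj_on (\<lambda>x. N - x) {..N::nat}"
  by (auto simp: inj_on_def)

lemma card_image_reflect: "X \<subseteq> {..N::nat} \<Longrightarrow> card ((\<lambda>x. N - x) ` X) = card X"
  by (rule card_image, rule inj_on_subset[OF inj_on_reflect])

lemma mem_image_reflect:
  assumes "X \<subseteq> {..N::nat}"
  shows "y \<in> (\<lambda>x. N - x) ` X \<longleftrightarrow> y \<le> N \<and> N - y \<in> X"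
proof
  assume "y \<in> (\<lambda>x. N - x) ` X"
  then obtain x where "x \<in> X" "y = N - x" by auto
  then show "y \<le> N \<and> N - y \<in> X" using assms by auto
next
  assume "y \<le> N \<and> N - y \<in> X"
  then show "y \<in> (\<lambda>x. N - x) ` X" by (intro image_eqI[of _ _ "N - y"]) auto
qed

text \<open>Reflection swaps small and large values, complementation swaps present and missing ones.
  Hence the second half of a permutation can be treated like a first half, with
  \<open>(m, D)\<close> and \<open>(k, E)\<close> exchanged.\<close>

lemma reflect_complement_glue:
  assumes "D \<subseteq> {1..m}" "E \<subseteq> {1..k}"
  shows "(\<lambda>x. m + k + 1 - x) ` ({1..m + k} - glue m k D E) = glue k m E D"
proof (rule Set.set_eqI)
  fix y
  have "y \<in> (\<lambda>x. m + k + 1 - x) ` ({1..m + k} - glue m k D E) \<longleftrightarrow>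
      y \<le> m + k + 1 \<and> m + k + 1 - y \<in> {1..m + k} - glue m k D E"
    by (rule mem_image_reflect) auto
  also have "\<dots> \<longleftrightarrow> y \<in> glue k m E D"
  proof (cases "y \<in> {1..m + k}")
    case True
    then have "m + k + 1 - (m + k + 1 - y) = y" "m + k + 1 - y \<le> m \<longleftrightarrow> \<not> y \<le> k" by auto
    with True show ?thesis by (auto simp: glue_def add.commute[of k m])
  qed (auto simp: glue_def)
  finally show "y \<in> (\<lambda>x. m + k + 1 - x) ` ({1..m + k} - glue m k D E) \<longleftrightarrow> y \<in> glue k m E D" .
qed

text \<open>All of \<open>D\<close> lies under the bound; the values
  \<open>m + 1, ..., m + 1 + j\<close> reflect to \<open>{k - j..k}\<close>, where \<open>E\<close>
  marks the missing ones.\<close>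

lemma card_glue_inter:
  assumes D: "D \<subseteq> {1..m}" and E: "E \<subseteq> {1..k}" and j: "j < k"
  shows "card (glue m k D E \<inter> {..m + 1 + j}) = card D + (j + 1 - card (E \<inter> {k - j..k}))"
proof -
  let ?r = "\<lambda>x. m + k + 1 - x"
  have fin: "finite D" "finite E" using D E finite_subset by blast+
  have "glue m k D E \<inter> {..m + 1 + j} = D \<union> ?r ` ({k - j..k} - E)"
  proof (rule Set.set_eqI)
    fix y
    have "y \<in> ?r ` ({k - j..k} - E) \<longleftrightarrow> y \<le> m + k + 1 \<and> ?r y \<in> {k - j..k} - E"
      by (rule mem_image_reflect) auto
    moreover have "?r y \<in> {k - j..k} \<longleftrightarrow> m < y \<and> y \<le> m + 1 + j" if "y \<le> m + k + 1"
      using that j by auto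
    ultimately show "y \<in> glue m k D E \<inter> {..m + 1 + j} \<longleftrightarrow> y \<in> D \<union> ?r ` ({k - j..k} - E)"
      using D j by (auto simp: glue_def)
  qed
  moreover have "card (D \<union> ?r ` ({k - j..k} - E)) = card D + card (?r ` ({k - j..k} - E))"
    using fin D by (intro card_Un_disjoint) force+
  moreover have "card (?r ` ({k - j..k} - E)) = card ({k - j..k} - E)"
    by (rule card_image_reflect) auto
  moreover have "card ({k - j..k} - E) = j + 1 - card (E \<inter> {k - j..k})"
    using fin j by (simp add: card_Diff_subset_Int Int_commute)
  ultimately show ?thesis by simp
qed

lemma card_glue:
  assumes D: "D \<subseteq> {1..m}" and E: "E \<subseteq> {1..k}"
  shows "card (glue m k D E) = card D + (k - card E)"
proof (cases k)
  case 0
  then have "glue m k D E = D" using D by (auto simp: glue_def)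
  then show ?thesis using 0 E by simp
next
  case (Suc j)
  then have "glue m k D E \<inter> {..m + 1 + j} = glue m k D E" "E \<inter> {k - j..k} = E"
    using E by (auto simp: glue_def)
  then show ?thesis using card_glue_inter[OF D E, of j] Suc by simp
qed

text \<open>With \<open>j = k - s\<close>, the number of choices at place \<open>j\<close> is
  \<open>card D + (j + 1 - card (E \<inter> {s..k})) - j\<close>. As \<open>card D = card E\<close>,
  it depends on \<open>E\<close> alone, which decouples the two sets.\<close>

lemma sum_bounded_words_glue:
  assumes D: "D \<subseteq> {1..m}" and E: "E \<subseteq> {1..k}" and eq: "card D = card E"
  shows "(\<Sum>ys\<in>bounded_words (m + 1) k (glue m k D E). q ^ list_inv ys) =
    (\<Prod>s=1..k. q_int q (card E + 1 - card (E \<inter> {s..k})))"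
proof -
  have "card E \<le> k" using card_mono[OF _ E] by simp
  then have "card (glue m k D E) = k" using card_glue[OF D E] eq by simp
  moreover have "finite (glue m k D E)" by (simp add: glue_def)
  ultimately have "(\<Sum>ys\<in>bounded_words (m + 1) k (glue m k D E). q ^ list_inv ys) =
      (\<Prod>j<k. q_int q (card (glue m k D E \<inter> {..m + 1 + j}) - j))"
    by (rule sum_bounded_words[rotated])
  also have "\<dots> = (\<Prod>s=1..k. q_int q (card E + 1 - card (E \<inter> {s..k})))"
  proof (rule prod.reindex_bij_witness[of _ "\<lambda>s. k - s" "\<lambda>j. k - j"])
    fix j assume "j \<in> {..<k}"
    then have j: "j < k" by simp
    have "card (E \<inter> {k - j..k}) \<le> card {k - j..k}" by (rule card_mono) auto
    then show "q_int q (card E + 1 - card (E \<inter> {k - j..k})) =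
        q_int q (card (glue m k D E \<inter> {..m + 1 + j}) - j)"
      using j by (simp add: card_glue_inter[OF D E j, simplified] eq)
  qed auto
  finally show ?thesis .
qed

text \<open>Sort the pairs by the cut at \<open>m\<close>. A large member and a small missing value
  always form a pair, which gives the product; a small member never exceeds a large missing value.
  Small pairs are those of \<open>D\<close>, large pairs those of \<open>E\<close> after reflection,
  which reverses the order and swaps members with missing values.\<close>

lemma subset_inv_glue:
  assumes D: "D \<subseteq> {1..m}" and E: "E \<subseteq> {1..k}"
  shows "subset_inv (m + k) (glue m k D E) =
    (k - card E) * (m - card D) + subset_inv m D + subset_inv k E"
proof -
  let ?r = "\<lambda>x. m + k + 1 - x"
  let ?G = "glue m k D E"
  let ?X1 = "{(d, r). d \<in> D \<and> r \<in> {1..m} - D \<and> r < d}"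
  let ?Y2 = "{(e, a). e \<in> E \<and> a \<in> {1..k} - E \<and> a < e}"
  let ?X2 = "{(a, b). m < a \<and> a \<le> m + k \<and> m < b \<and> b \<le> m + k \<and> ?r b \<in> E \<and> ?r a \<notin> E \<and> b < a}"
  let ?H = "{a. m < a \<and> a \<le> m + k \<and> ?r a \<notin> E}"
  let ?X3 = "?H \<times> ({1..m} - D)"
  have fin: "finite D" "finite E" using D E finite_subset by blast+
  have le_D: "d \<le> m" "1 \<le> d" if "d \<in> D" for d using D that by auto
  have le_E: "e \<le> k" "1 \<le> e" if "e \<in> E" for e using E that by auto
  have refl_E: "Suc (m + k) - (Suc (m + k) - e) = e" if "e \<in> E" for e
    using le_E(1)[OF that] by simp
  have G_eq: "?G = D \<union> ?H"
    by (auto simp: glue_def dest: le_D)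
  have split: "{(a, b). a \<in> ?G \<and> b \<in> {1..m + k} - ?G \<and> b < a} = ?X3 \<union> (?X1 \<union> ?X2)"
    unfolding G_eq by (auto dest: le_D)
  have fin1: "finite ?X1"
    by (rule finite_subset[of _ "D \<times> {1..m}"]) (use fin in auto)
  have fin2: "finite ?X2"
    by (rule finite_subset[of _ "{..m + k} \<times> {..m + k}"]) auto
  have finH: "finite ?H"
    by (rule finite_subset[of _ "{..m + k}"]) auto
  have "subset_inv (m + k) ?G = card ?X3 + card (?X1 \<union> ?X2)"
    unfolding subset_inv_def split
    by (rule card_Un_disjoint) (use fin1 fin2 finH in \<open>auto dest: le_D\<close>)
  also have "card (?X1 \<union> ?X2) = card ?X1 + card ?X2"
    by (rule card_Un_disjoint) (use fin1 fin2 in \<open>auto dest: le_D\<close>)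
  also have "card ?X2 = card ?Y2"
    by (rule bij_betw_same_card[of "\<lambda>(a, b). (?r b, ?r a)"],
        rule bij_betwI[of _ _ _ "\<lambda>(e, a). (?r a, ?r e)"])
      (auto simp: refl_E dest: le_E)
  also have "?H = ?r ` ({1..k} - E)"
  proof (rule Set.set_eqI)
    fix a
    have "a \<in> ?r ` ({1..k} - E) \<longleftrightarrow> a \<le> m + k + 1 \<and> ?r a \<in> {1..k} - E"
      by (rule mem_image_reflect) auto
    then show "a \<in> ?H \<longleftrightarrow> a \<in> ?r ` ({1..k} - E)" by auto
  qed
  also have "card (?r ` ({1..k} - E) \<times> ({1..m} - D)) = (k - card E) * (m - card D)"
  proof -
    have "card (?r ` ({1..k} - E)) = card ({1..k} - E)" by (rule card_image_reflect) auto
    then show ?thesis using fin D E by (simp add: card_cartesian_product card_Diff_subset)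
  qed
  finally show ?thesis by (simp add: subset_inv_def)
qed

lemma glue_inverse:
  assumes "A \<subseteq> {1..m + k}"
  shows "glue m k (A \<inter> {1..m}) {x \<in> {1..k}. m + k + 1 - x \<notin> A} = A"
proof (rule Set.set_eqI)
  fix x show "x \<in> glue m k (A \<inter> {1..m}) {x \<in> {1..k}. m + k + 1 - x \<notin> A} \<longleftrightarrow> x \<in> A"
  proof (cases "x \<in> {1..m + k}")
    case True
    then have "m + k + 1 - (m + k + 1 - x) = x" "m + k + 1 - x \<in> {1..k} \<longleftrightarrow> \<not> x \<le> m" by auto
    with True show ?thesis by (auto simp: glue_def)
  qed (use assms in \<open>auto simp: glue_def\<close>)
qed

text \<open>Since \<open>card A = card D + (k - card E)\<close>, the condition
  \<open>card A = k\<close> amounts to \<open>card D = card E\<close>.\<close>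

lemma sum_subsets_glue:
  "(\<Sum>A | A \<subseteq> {1..m + k} \<and> card A = k. f A) =
    (\<Sum>(D, E) | D \<subseteq> {1..m} \<and> E \<subseteq> {1..k} \<and> card D = card E. f (glue m k D E))"
proof (rule sum.reindex_bij_witness[of _ "\<lambda>(D, E). glue m k D E"
      "\<lambda>A. (A \<inter> {1..m}, {x \<in> {1..k}. m + k + 1 - x \<notin> A})"])
  fix A assume A: "A \<in> {A. A \<subseteq> {1..m + k} \<and> card A = k}"
  let ?D = "A \<inter> {1..m}" and ?E = "{x \<in> {1..k}. m + k + 1 - x \<notin> A}"
  have inv: "glue m k ?D ?E = A" using A glue_inverse by blast
  then show "(case (?D, ?E) of (D, E) \<Rightarrow> glue m k D E) = A" by simp
  show "(case (?D, ?E) of (D, E) \<Rightarrow> f (glue m k D E)) = f A" using inv by simp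
  have "card A = card ?D + (k - card ?E)"
    by (subst inv[symmetric], rule card_glue) auto
  moreover have "card ?E \<le> card {1..k}" by (rule card_mono) auto
  moreover have "card A = k" using A by simp
  ultimately have "card ?D = card ?E" using card_atLeastAtMost[of 1 k] by linarith
  then show "(?D, ?E) \<in> {(D, E). D \<subseteq> {1..m} \<and> E \<subseteq> {1..k} \<and> card D = card E}" by auto
next
  fix DE assume "DE \<in> {(D, E). D \<subseteq> {1..m} \<and> E \<subseteq> {1..k} \<and> card D = card E}"
  then obtain D E where DE: "DE = (D, E)" "D \<subseteq> {1..m}" "E \<subseteq> {1..k}" "card D = card E" by auto
  have "card E \<le> k" using card_mono[OF _ DE(3)] by simp
  then have "card (glue m k D E) = k" using card_glue[OF DE(2,3)] DE(4) by simp
  then show "(case DE of (D, E) \<Rightarrow> glue m k D E) \<in> {A. A \<subseteq> {1..m + k} \<and> card A = k}"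
    using DE(1) by (auto simp: glue_def)
  have "glue m k D E \<inter> {1..m} = D" using DE(2) by (auto simp: glue_def)
  moreover have "m + k + 1 - x \<notin> glue m k D E \<longleftrightarrow> x \<in> E" if "x \<in> {1..k}" for x
  proof -
    have "m + k + 1 - (m + k + 1 - x) = x" using that by simp
    then show ?thesis using that by (auto simp: glue_def)
  qed
  then have "{x \<in> {1..k}. m + k + 1 - x \<notin> glue m k D E} = E" using DE(3) by blast
  ultimately show "((case DE of (D, E) \<Rightarrow> glue m k D E) \<inter> {1..m},
      {x \<in> {1..k}. m + k + 1 - x \<notin> (case DE of (D, E) \<Rightarrow> glue m k D E)}) = DE"
    using DE(1) by simp
qed

section \<open>Permutations in a band\<close>

text \<open>List index \<open>j\<close> stands for position \<open>j + 1\<close>; the lower bound is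
  written additively to avoid truncated subtraction.\<close>

definition band_words :: "nat \<Rightarrow> nat \<Rightarrow> nat list set" where
  "band_words m k = {xs. distinct xs \<and> set xs = {1..m + k} \<and>
     (\<forall>j<m + k. j + 1 \<le> xs ! j + k \<and> xs ! j \<le> j + 1 + m)}"

lemma map_reflect_reflect:
  "set us \<subseteq> {..N::nat} \<Longrightarrow> map ((\<lambda>x. N - x) \<circ> (\<lambda>x. N - x)) us = us"
  by (induction us) auto

lemma image_reflect_reflect:
  assumes "X \<subseteq> {..N::nat}"
  shows "(\<lambda>x. N - x) ` (\<lambda>x. N - x) ` X = X"
proof -
  have "(\<lambda>x. N - (N - x)) ` X = (\<lambda>x. x) ` X" using assms by (intro image_cong) auto
  then show ?thesis by (simp add: image_image)
qed

text \<open>The first \<open>k\<close> places keep their upper bounds, the last \<open>m\<close>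
  places their lower bounds, which become upper bounds after reversal and reflection. Inversions
  across the cut depend only on the set of values in the first half.\<close>

lemma split_band_word:
  fixes m k :: nat
  defines "r \<equiv> \<lambda>x. m + k + 1 - x"
  assumes xs: "xs \<in> band_words m k"
  shows "take k xs \<in> bounded_words (m + 1) k (set (take k xs))"
    and "rev (map r (drop k xs)) \<in> bounded_words (k + 1) m (r ` ({1..m + k} - set (take k xs)))"
    and "list_inv xs = subset_inv (m + k) (set (take k xs)) + list_inv (take k xs) +
      list_inv (rev (map r (drop k xs)))"
proof -
  have d: "distinct xs" and s: "set xs = {1..m + k}"
    and b: "\<And>j. j < m + k \<Longrightarrow> j + 1 \<le> xs ! j + k \<and> xs ! j \<le> j + 1 + m"
    using xs by (auto simp: band_words_def)
  have len: "length xs = m + k" using distinct_card[OF d] s by simp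
  show "take k xs \<in> bounded_words (m + 1) k (set (take k xs))"
    using d b len by (auto simp: bounded_words_def add.commute)
  have app: "xs = take k xs @ drop k xs" by simp
  have "set xs = set (take k xs) \<union> set (drop k xs)"
    by (subst app, subst set_append) (rule refl)
  moreover have "set (take k xs) \<inter> set (drop k xs) = {}"
    using d by (rule set_take_disj_set_drop_if_distinct) simp
  ultimately have set_drop: "set (drop k xs) = {1..m + k} - set (take k xs)"
    using s by blast
  have inj: "inj_on r (set (drop k xs))"
    unfolding r_def by (rule inj_on_subset[OF inj_on_reflect]) (auto simp: set_drop)
  \<comment> \<open>Place \<open>j\<close> of the reversed half is place
    \<open>k + m - 1 - j\<close> of \<open>xs\<close>, with lower bound \<open>m - j\<close>, which
    reflects to \<open>k + 1 + j\<close>.\<close>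
  have "rev (map r (drop k xs)) ! j \<le> k + 1 + j" if j: "j < m" for j
  proof -
    have "rev (map r (drop k xs)) ! j = r (xs ! (k + (m - Suc j)))"
      using j len by (simp add: rev_nth)
    moreover have "k + (m - Suc j) + 1 \<le> xs ! (k + (m - Suc j)) + k"
      using b[of "k + (m - Suc j)"] j by simp
    ultimately show ?thesis using j unfolding r_def by linarith
  qed
  then show "rev (map r (drop k xs)) \<in> bounded_words (k + 1) m (r ` ({1..m + k} - set (take k xs)))"
    using d len inj by (simp add: bounded_words_def distinct_map set_drop)
  have "list_inv (rev (map r (drop k xs))) = list_inv (drop k xs)"
    unfolding r_def by (rule list_inv_rev_reflect) (use d in \<open>auto simp: set_drop\<close>)
  moreover have "list_inv xs = list_inv (take k xs) + list_inv (drop k xs) +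
      subset_inv (m + k) (set (take k xs))"
    using list_inv_append[of "take k xs" "drop k xs"] d
    by (simp only: append_take_drop_id set_drop subset_inv_def simp_thms)
  ultimately show "list_inv xs = subset_inv (m + k) (set (take k xs)) + list_inv (take k xs) +
      list_inv (rev (map r (drop k xs)))" by simp
qed

text \<open>The bounds not recorded in the halves follow from the values lying in
  \<open>{1..m + k}\<close>: for \<open>j < k\<close> the lower bound is at most \<open>0\<close>,
  for \<open>j \<ge> k\<close> the upper bound exceeds \<open>m + k\<close>.\<close>

lemma append_band_word:
  fixes m k :: nat
  defines "r \<equiv> \<lambda>x. m + k + 1 - x"
  assumes A: "A \<subseteq> {1..m + k}"
    and ys: "ys \<in> bounded_words (m + 1) k A"
    and us: "us \<in> bounded_words (k + 1) m (r ` ({1..m + k} - A))"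
  shows "ys @ rev (map r us) \<in> band_words m k"
    and "rev (map r (rev (map r us))) = us"
proof -
  have set_us: "set us = r ` ({1..m + k} - A)" using us by (simp add: bounded_words_def)
  have le_us: "set us \<subseteq> {1..m + k}" unfolding set_us r_def by auto
  have us_le: "set us \<subseteq> {..m + k + 1}" using le_us by auto
  have rr: "r ` set us = {1..m + k} - A"
    unfolding set_us r_def by (rule image_reflect_reflect) auto
  have inj: "inj_on r (set us)"
    unfolding r_def by (rule inj_on_subset[OF inj_on_reflect us_le])
  have len: "length ys = k" "length us = m" using ys us by (auto simp: bounded_words_def)
  have "j + 1 \<le> (ys @ rev (map r us)) ! j + k \<and> (ys @ rev (map r us)) ! j \<le> j + 1 + m"
    if j: "j < m + k" for j
  proof (cases "j < k")
    case True
    then show ?thesis using ys len by (auto simp: nth_append bounded_words_def)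
  next
    case False
    let ?p = "m - Suc (j - k)"
    have p: "?p < m" using j False by auto
    have "(ys @ rev (map r us)) ! j = r (us ! ?p)"
      using False j len by (simp add: nth_append rev_nth)
    moreover have "us ! ?p \<le> k + 1 + ?p"
      using us p by (simp add: bounded_words_def)
    moreover have "us ! ?p \<in> set us" using p len by simp
    then have "us ! ?p \<in> {1..m + k}" using le_us by blast
    ultimately show ?thesis using False j unfolding r_def by auto
  qed
  then show "ys @ rev (map r us) \<in> band_words m k"
    using ys us inj rr A by (auto simp: band_words_def bounded_words_def distinct_map)
  show "rev (map r (rev (map r us))) = us"
    using map_reflect_reflect[OF us_le] by (simp add: r_def rev_map)
qed

lemma sum_band_words:
  fixes q :: "'a::comm_semiring_1"
  shows "(\<Sum>xs\<in>band_words m k. q ^ list_inv xs) =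
    (\<Sum>A | A \<subseteq> {1..m + k} \<and> card A = k. q ^ subset_inv (m + k) A *
      (\<Sum>ys\<in>bounded_words (m + 1) k A. q ^ list_inv ys) *
      (\<Sum>us\<in>bounded_words (k + 1) m ((\<lambda>x. m + k + 1 - x) ` ({1..m + k} - A)). q ^ list_inv us))"
proof -
  let ?r = "\<lambda>x. m + k + 1 - x"
  let ?S = "{A. A \<subseteq> {1..m + k} \<and> card A = k}"
  let ?Y = "\<lambda>A. bounded_words (m + 1) k A"
  let ?U = "\<lambda>A. bounded_words (k + 1) m (?r ` ({1..m + k} - A))"
  have "(\<Sum>xs\<in>band_words m k. q ^ list_inv xs) =
      (\<Sum>(A, ys, us)\<in>(SIGMA A:?S. ?Y A \<times> ?U A).
         q ^ (subset_inv (m + k) A + list_inv ys + list_inv us))"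
  proof (rule sum.reindex_bij_witness[of _ "\<lambda>(A, ys, us). ys @ rev (map ?r us)"
        "\<lambda>xs. (set (take k xs), take k xs, rev (map ?r (drop k xs)))"])
    fix xs assume xs: "xs \<in> band_words m k"
    have set_xs: "set xs = {1..m + k}" "distinct xs" using xs by (auto simp: band_words_def)
    have len: "length xs = m + k" using distinct_card[OF set_xs(2)] set_xs(1) by simp
    have "set (drop k xs) \<subseteq> {..m + k + 1}" using set_drop_subset[of k xs] set_xs by auto
    from map_reflect_reflect[OF this]
    show "(case (set (take k xs), take k xs, rev (map ?r (drop k xs))) of
        (A, ys, us) \<Rightarrow> ys @ rev (map ?r us)) = xs"
      by (simp add: rev_map)
    have "set (take k xs) \<subseteq> {1..m + k}" using set_take_subset[of k xs] set_xs by auto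
    moreover have "card (set (take k xs)) = k"
      using set_xs len by (simp add: distinct_card)
    ultimately show "(set (take k xs), take k xs, rev (map ?r (drop k xs))) \<in>
        (SIGMA A:?S. ?Y A \<times> ?U A)"
      using split_band_word(1,2)[OF xs] by blast
    show "(case (set (take k xs), take k xs, rev (map ?r (drop k xs))) of (A, ys, us) \<Rightarrow>
        q ^ (subset_inv (m + k) A + list_inv ys + list_inv us)) = q ^ list_inv xs"
      using split_band_word(3)[OF xs] by simp
  next
    fix t assume "t \<in> (SIGMA A:?S. ?Y A \<times> ?U A)"
    then obtain A ys us where t: "t = (A, ys, us)" "A \<subseteq> {1..m + k}" "ys \<in> ?Y A" "us \<in> ?U A"
      by auto
    show "(case t of (A, ys, us) \<Rightarrow> ys @ rev (map ?r us)) \<in> band_words m k"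
      using append_band_word(1)[OF t(2-4)] t(1) by simp
    have "length ys = k" "set ys = A" using t(3) by (auto simp: bounded_words_def)
    then show "(set (take k (case t of (A, ys, us) \<Rightarrow> ys @ rev (map ?r us))),
        take k (case t of (A, ys, us) \<Rightarrow> ys @ rev (map ?r us)),
        rev (map ?r (drop k (case t of (A, ys, us) \<Rightarrow> ys @ rev (map ?r us))))) = t"
      using append_band_word(2)[OF t(2-4)] t(1) by simp
  qed
  also have "\<dots> = (\<Sum>A\<in>?S. \<Sum>(ys, us)\<in>?Y A \<times> ?U A.
         q ^ (subset_inv (m + k) A + list_inv ys + list_inv us))"
  proof (subst sum.Sigma)
    show "finite ?S" by (rule finite_subset[of _ "Pow {1..m + k}"]) auto
    show "\<forall>A\<in>?S. finite (?Y A \<times> ?U A)"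
      by (auto intro!: finite_bounded_words dest: finite_subset)
  qed (simp add: case_prod_beta)
  also have "\<dots> = (\<Sum>A\<in>?S. q ^ subset_inv (m + k) A *
      (\<Sum>ys\<in>?Y A. q ^ list_inv ys) * (\<Sum>us\<in>?U A. q ^ list_inv us))"
    by (simp only: mult.assoc sum_product)
      (simp add: sum.cartesian_product[symmetric] power_add sum_distrib_left mult.assoc)
  finally show ?thesis .
qed

text \<open>The mixed factor from \<open>subset_inv_glue\<close> depends only on the common
  cardinality \<open>i\<close>, so for fixed \<open>i\<close> the sums over \<open>D\<close> and
  \<open>E\<close> separate.\<close>

lemma sum_band_words_subset_gf:
  fixes q :: "'a::comm_semiring_1"
  shows "(\<Sum>xs\<in>band_words m k. q ^ list_inv xs) =
    (\<Sum>i=0..k. q ^ ((k - i) * (m - i)) * subset_gf q m i * subset_gf q k i)"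
proof -
  let ?r = "\<lambda>x. m + k + 1 - x"
  let ?S = "\<lambda>m i. {D. D \<subseteq> {1..m::nat} \<and> card D = i}"
  let ?P = "{(D, E). D \<subseteq> {1..m} \<and> E \<subseteq> {1..k} \<and> card D = card E}"
  let ?w = "\<lambda>D E. q ^ ((k - card D) * (m - card D)) * subset_weight q m D * subset_weight q k E"
  have "(\<Sum>xs\<in>band_words m k. q ^ list_inv xs) = (\<Sum>(D, E)\<in>?P. q ^ subset_inv (m + k) (glue m k D E) *
      (\<Sum>ys\<in>bounded_words (m + 1) k (glue m k D E). q ^ list_inv ys) *
      (\<Sum>us\<in>bounded_words (k + 1) m (?r ` ({1..m + k} - glue m k D E)). q ^ list_inv us))"
    unfolding sum_band_words by (rule sum_subsets_glue)
  also have "\<dots> = (\<Sum>(D, E)\<in>?P. ?w D E)"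
  proof (rule sum.cong[OF refl], clarify)
    fix D E assume D: "D \<subseteq> {1..m}" and E: "E \<subseteq> {1..k}" and eq: "card D = card E"
    show "q ^ subset_inv (m + k) (glue m k D E) *
      (\<Sum>ys\<in>bounded_words (m + 1) k (glue m k D E). q ^ list_inv ys) *
      (\<Sum>us\<in>bounded_words (k + 1) m (?r ` ({1..m + k} - glue m k D E)). q ^ list_inv us) = ?w D E"
      unfolding reflect_complement_glue[OF D E] sum_bounded_words_glue[OF D E eq]
        sum_bounded_words_glue[OF E D eq[symmetric]] subset_inv_glue[OF D E] subset_weight_def
      by (simp add: power_add eq ac_simps)
  qed
  also have "\<dots> = (\<Sum>(i, D, E)\<in>(SIGMA i:{0..k}. ?S m i \<times> ?S k i).
      q ^ ((k - i) * (m - i)) * subset_weight q m D * subset_weight q k E)"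
  proof (rule sum.reindex_bij_witness[of _ snd "\<lambda>(D, E). (card D, D, E)"])
    fix DE assume "DE \<in> ?P"
    then obtain D E where DE: "DE = (D, E)" "D \<subseteq> {1..m}" "E \<subseteq> {1..k}" "card D = card E" by auto
    moreover have "card E \<le> k" using card_mono[OF _ DE(3)] by simp
    ultimately show "(case DE of (D, E) \<Rightarrow> (card D, D, E)) \<in> (SIGMA i:{0..k}. ?S m i \<times> ?S k i)"
      by simp
  qed auto
  also have "\<dots> = (\<Sum>i=0..k. \<Sum>(D, E)\<in>?S m i \<times> ?S k i.
      q ^ ((k - i) * (m - i)) * subset_weight q m D * subset_weight q k E)"
  proof (subst sum.Sigma)
    have "finite (?S m i)" for m i by (rule finite_subset[of _ "Pow {1..m}"]) auto
    then show "\<forall>i\<in>{0..k}. finite (?S m i \<times> ?S k i)" by simp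
  qed (simp_all add: case_prod_beta)
  also have "\<dots> = (\<Sum>i=0..k. q ^ ((k - i) * (m - i)) * subset_gf q m i * subset_gf q k i)"
    unfolding subset_gf_def
    by (simp only: mult.assoc sum_product)
      (simp add: sum.cartesian_product[symmetric] sum_distrib_left)
  finally show ?thesis .
qed

lemma sum_band_words_q_stirling:
  fixes q :: "'a::field"
  assumes "q \<noteq> 0"
  shows "(\<Sum>xs\<in>band_words m k. q ^ list_inv xs) =
    q ^ (m * k) * (\<Sum>i=0..k. q_stirling (1 / q) (k + 1) (i + 1) * q_stirling (1 / q) (m + 1) (i + 1) *
      (q_fact q i)\<^sup>2 * q ^ i)"
  unfolding sum_band_words_subset_gf sum_distrib_left
proof (rule sum.cong[OF refl])
  fix i assume "i \<in> {0..k}"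
  then have ik: "i \<le> k" by simp
  let ?Sk = "q_stirling (1 / q) (k + 1) (i + 1)" and ?Sm = "q_stirling (1 / q) (m + 1) (i + 1)"
  let ?c = "q ^ (i choose 2)"
  have gf: "subset_gf q l i * ?c = q_fact q i * q ^ (i * l) * q_stirling (1 / q) (l + 1) (i + 1)" for l
    by (rule subset_gf_eq_q_stirling[OF assms])
  show "q ^ ((k - i) * (m - i)) * subset_gf q m i * subset_gf q k i =
    q ^ (m * k) * (?Sk * ?Sm * (q_fact q i)\<^sup>2 * q ^ i)"
  proof (cases "i \<le> m")
    case True
    obtain a b where ab: "k = i + a" "m = i + b" using ik True by (auto simp: le_iff_add)
    \<comment> \<open>The exponents add up to \<open>m * k + i * i\<close>; the part
      \<open>2 * (i choose 2)\<close> cancels against the two factors \<open>?c\<close>.\<close>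
    have "2 * (i choose 2) + i = i * i"
      by (induction i) (auto simp: numeral_2_eq_2)
    then have expo: "(k - i) * (m - i) + i * m + i * k = m * k + i + 2 * (i choose 2)"
      by (simp add: ab algebra_simps)
    have "q ^ ((k - i) * (m - i)) * subset_gf q m i * subset_gf q k i * (?c * ?c) =
        q ^ ((k - i) * (m - i)) * (subset_gf q m i * ?c) * (subset_gf q k i * ?c)"
      by (simp only: ac_simps)
    also have "\<dots> = q ^ ((k - i) * (m - i) + i * m + i * k) * (?Sk * ?Sm * (q_fact q i)\<^sup>2)"
      by (simp only: gf power_add power2_eq_square ac_simps)
    also have "\<dots> = q ^ (m * k) * (?Sk * ?Sm * (q_fact q i)\<^sup>2 * q ^ i) * (?c * ?c)"
      unfolding expo by (simp only: power_add mult_2 ac_simps)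
    finally show ?thesis using assms by simp
  next
    case False
    \<comment> \<open>For \<open>i > m\<close> the exponent on the left is truncated, but both sides
      are zero: \<open>subset_gf q m i\<close> vanishes, and \<open>gf\<close> then forces
      \<open>q_fact q i * ?Sm = 0\<close>.\<close>
    then have "q_fact q i * q ^ (i * m) * ?Sm = 0" using gf[of m] by (simp add: subset_gf_eq_0)
    then have "q_fact q i * ?Sm = 0" using assms by (auto simp del: q_stirling.simps)
    then have "?Sk * ?Sm * (q_fact q i)\<^sup>2 * q ^ i = 0"
      by (auto simp del: q_stirling.simps)
    then show ?thesis using False by (simp only: subset_gf_eq_0) simp
  qed
qed

section \<open>Permutations and their one-line words\<close>

definition band_perms :: "nat \<Rightarrow> nat \<Rightarrow> (nat \<Rightarrow> nat) set" where
  "band_perms n k = {v. v permutes {1..n} \<and> (\<forall>i\<in>{1..n}. i \<le> v i + k \<and> v i \<le> i + (n - k))}"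

lemma sum_band_perms:
  assumes "k \<le> n"
  shows "(\<Sum>v\<in>band_perms n k. q ^ perm_length n v) = (\<Sum>xs\<in>band_words (n - k) k. q ^ list_inv xs)"
proof (rule sum.reindex_bij_witness[of _ "\<lambda>xs i. if i \<in> {1..n} then xs ! (i - 1) else i"
      "\<lambda>v. map v [1..<n + 1]"])
  fix v assume v: "v \<in> band_perms n k"
  then have perm: "v permutes {1..n}" by (simp add: band_perms_def)
  have nth: "map v [1..<n + 1] ! j = v (j + 1)" if "j < n" for j
    using that by (simp del: upt_Suc)
  show "(\<lambda>i. if i \<in> {1..n} then map v [1..<n + 1] ! (i - 1) else i) = v"
  proof
    fix i show "(if i \<in> {1..n} then map v [1..<n + 1] ! (i - 1) else i) = v i"
      using nth[of "i - 1"] permutes_not_in[OF perm, of i] by auto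
  qed
  have inj: "inj_on v {1..n}" using perm by (rule permutes_inj_on)
  have iv: "{1..n} = {1..<n + 1}" by auto
  have "v ` {1..n} = {1..n}" using perm by (rule permutes_image)
  then have set_v: "set (map v [1..<n + 1]) = {1..n - k + k}"
    using assms by (simp only: set_map set_upt iv[symmetric]) simp
  have "distinct (map v [1..<n + 1])"
    unfolding distinct_map using inj by (simp only: set_upt distinct_upt iv[symmetric] simp_thms)
  moreover have "j + 1 \<le> map v [1..<n + 1] ! j + k \<and> map v [1..<n + 1] ! j \<le> j + 1 + (n - k)"
    if "j < n - k + k" for j
  proof -
    have "j + 1 \<in> {1..n}" "j < n" using that assms by auto
    then show ?thesis unfolding nth[OF \<open>j < n\<close>] using v unfolding band_perms_def by blast
  qed
  ultimately show "map v [1..<n + 1] \<in> band_words (n - k) k"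
    unfolding band_words_def using set_v by blast
  show "q ^ list_inv (map v [1..<n + 1]) = q ^ perm_length n v"
    using perm_length_eq_list_inv[OF inj] by simp
next
  fix xs assume "xs \<in> band_words (n - k) k"
  then have d: "distinct xs" and s: "set xs = {1..n}"
    and b: "\<And>j. j < n \<Longrightarrow> j + 1 \<le> xs ! j + k \<and> xs ! j \<le> j + 1 + (n - k)"
    using assms by (auto simp: band_words_def)
  let ?v = "\<lambda>i. if i \<in> {1..n} then xs ! (i - 1) else i"
  have len: "length xs = n" using distinct_card[OF d] s by simp
  show map_v: "map ?v [1..<n + 1] = xs"
    by (rule nth_equalityI) (use len in \<open>auto simp del: upt_Suc\<close>)
  have inj: "inj_on ?v {1..n}"
    by (rule inj_onI) (use d len in \<open>auto simp: nth_eq_iff_index_eq\<close>)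
  have iv: "{1..n} = {1..<n + 1}" by auto
  have "?v ` {1..n} = set (map ?v [1..<n + 1])" by (simp only: set_map set_upt iv)
  also have "\<dots> = {1..n}" unfolding map_v by (rule s)
  finally have "bij_betw ?v {1..n} {1..n}" using inj by (simp add: bij_betw_def)
  then have "?v permutes {1..n}" by (rule bij_imp_permutes) auto
  moreover have "i \<le> ?v i + k \<and> ?v i \<le> i + (n - k)" if "i \<in> {1..n}" for i
    using b[of "i - 1"] that by auto
  ultimately show "?v \<in> band_perms n k" by (simp add: band_perms_def)
qed

section \<open>Bruhat order\<close>

text \<open>Acting by the transposition \<open>t\<close> on pairs of positions maps the inversions of \<open>u\<close> into those of
  \<open>u \<circ> t\<close>, except for the pairs whose order \<open>t\<close> reverses; these are inversions of both.\<close>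

lemma perm_length_transpose_less:
  assumes ij: "i \<in> {1..n}" "j \<in> {1..n}" "i < j" and u: "u i < u j"
  shows "perm_length n u < perm_length n (u \<circ> Transposition.transpose i j)"
proof -
  let ?t = "Transposition.transpose i j"
  let ?I = "\<lambda>f :: nat \<Rightarrow> nat. {(a, b). a \<in> {1..n} \<and> b \<in> {1..n} \<and> a < b \<and> f a > f b}"
  define \<phi> where "\<phi> = (\<lambda>(a, b). if ?t a < ?t b then (?t a, ?t b) else (a, b))"
  have t_inj: "?t x = ?t y \<longleftrightarrow> x = y" for x y by (metis transpose_involutory)
  have fin: "finite (?I f)" for f
    by (rule finite_subset[of _ "{1..n} \<times> {1..n}"]) auto
  have "inj_on \<phi> (?I u)"
  proof (rule inj_onI, clarify)
    fix a b c d assume "a < b" "c < d" "\<phi> (a, b) = \<phi> (c, d)"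
    then show "a = c \<and> b = d"
      by (auto simp: \<phi>_def t_inj split: if_splits)
  qed
  then have "card (\<phi> ` ?I u) = card (?I u)" by (rule card_image)
  moreover have "\<phi> ` ?I u \<subset> ?I (u \<circ> ?t)"
  proof
    show "\<phi> ` ?I u \<subseteq> ?I (u \<circ> ?t)"
    proof clarify
      fix a b x y
      assume ab: "a \<in> {1..n}" "b \<in> {1..n}" "a < b" "u b < u a" and xy: "(x, y) = \<phi> (a, b)"
      show "x \<in> {1..n} \<and> y \<in> {1..n} \<and> x < y \<and> (u \<circ> ?t) y < (u \<circ> ?t) x"
      proof (cases "?t a < ?t b")
        case True
        have "?t a \<in> {1..n}" "?t b \<in> {1..n}" using ab ij by (auto simp: transpose_def)
        then show ?thesis using True xy ab by (simp add: \<phi>_def)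
      next
        case False
        then show ?thesis using xy ab u ij
          by (auto simp: \<phi>_def transpose_def split: if_splits)
      qed
    qed
    have "(i, j) \<in> ?I (u \<circ> ?t)" using ij u by simp
    moreover have "(i, j) \<notin> \<phi> ` ?I u"
    proof
      assume "(i, j) \<in> \<phi> ` ?I u"
      then obtain a b where "a < b" "u b < u a" "\<phi> (a, b) = (i, j)" by force
      then show False
        using ij u by (auto simp: \<phi>_def transpose_def split: if_splits)
    qed
    ultimately show "\<phi> ` ?I u \<noteq> ?I (u \<circ> ?t)" by blast
  qed
  then have "card (\<phi> ` ?I u) < card (?I (u \<circ> ?t))" by (rule psubset_card_mono[OF fin])
  ultimately show ?thesis by (simp add: perm_length_def)
qed

lemma transpose_comp_cancel: "(u \<circ> Transposition.transpose i j) \<circ> Transposition.transpose i j = u"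
  by (simp add: fun_eq_iff)

lemma perm_length_less_transpose_iff:
  assumes u: "u permutes {1..n}" and ij: "i \<in> {1..n}" "j \<in> {1..n}" "i < j"
  shows "perm_length n u < perm_length n (u \<circ> Transposition.transpose i j) \<longleftrightarrow> u i < u j"
proof
  assume less: "perm_length n u < perm_length n (u \<circ> Transposition.transpose i j)"
  show "u i < u j"
  proof (rule ccontr)
    assume "\<not> u i < u j"
    moreover have "u i \<noteq> u j" using permutes_inj[OF u] ij by (auto simp: inj_eq)
    ultimately have "(u \<circ> Transposition.transpose i j) i < (u \<circ> Transposition.transpose i j) j" by simp
    from perm_length_transpose_less[OF ij this] less show False
      by (simp only: transpose_comp_cancel)
  qed
qed (rule perm_length_transpose_less[OF ij])

lemma permutes_comp_transpose:
  "u permutes S \<Longrightarrow> i \<in> S \<Longrightarrow> j \<in> S \<Longrightarrow> u \<circ> Transposition.transpose i j permutes S"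
  by (intro permutes_compose permutes_swap_id)

lemma bruhat_step_transpose:
  assumes "i \<in> {1..n}" "j \<in> {1..n}" "i < j" "u i < u j"
  shows "bruhat_step n u (u \<circ> Transposition.transpose i j)"
  using assms perm_length_transpose_less[OF assms] unfolding bruhat_step_def by blast

lemma bruhat_stepE:
  assumes "bruhat_step n u v" "v permutes {1..n}"
  obtains i j where "i \<in> {1..n}" "j \<in> {1..n}" "i < j" "u i < u j" "u permutes {1..n}"
    "v = u \<circ> Transposition.transpose i j"
proof -
  from assms(1) obtain i j where ij: "i \<in> {1..n}" "j \<in> {1..n}" "i < j"
    and v: "v = u \<circ> Transposition.transpose i j" and l: "perm_length n u < perm_length n v"
    unfolding bruhat_step_def by blast
  have "u = v \<circ> Transposition.transpose i j" by (simp add: v transpose_comp_cancel)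
  then have u: "u permutes {1..n}" using permutes_comp_transpose[OF assms(2) ij(1,2)] by simp
  then have "u i < u j" using perm_length_less_transpose_iff[OF u ij] l v by simp
  with that ij v u show thesis by blast
qed

text \<open>At the first moved point \<open>i\<close>, the value \<open>i\<close> sits at some
  \<open>j > i\<close> while \<open>v i > i\<close>. Exchanging the two is a step down, and
  induction on the length reaches \<open>id\<close>.\<close>

lemma bruhat_le_id:
  assumes "v permutes {1..n}"
  shows "bruhat_le n id v"
  using assms
proof (induction "perm_length n v" arbitrary: v rule: less_induct)
  case less
  show ?case
  proof (cases "v = id")
    case False
    then obtain i0 where "v i0 \<noteq> i0" by (auto simp: fun_eq_iff)
    define i where "i = (LEAST i. v i \<noteq> i)"
    have i: "v i \<noteq> i" unfolding i_def by (rule LeastI[of "\<lambda>i. v i \<noteq> i"]) fact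
    have min: "v a = a" if "a < i" for a using not_less_Least[OF that[unfolded i_def]] by simp
    have inj: "inj v" using less.prems by (rule permutes_inj)
    obtain j where j: "v j = i" using permutes_surj[OF less.prems] by (metis surjD)
    have "i \<in> {1..n}" "j \<in> {1..n}"
      using permutes_not_in[OF less.prems] i j by metis+
    moreover have "i < j" using i j min[of j] by (metis linorder_neqE_nat)
    moreover have "v j < v i" using i j min inj by (metis injD linorder_neqE_nat)
    ultimately have ij: "i \<in> {1..n}" "j \<in> {1..n}" "i < j" "v j < v i" by auto
    let ?u = "v \<circ> Transposition.transpose i j"
    have "bruhat_step n ?u (?u \<circ> Transposition.transpose i j)"
      by (rule bruhat_step_transpose) (use ij in auto)
    then have step: "bruhat_step n ?u v" by (simp add: transpose_comp_cancel)
    then have "perm_length n ?u < perm_length n v" by (auto simp: bruhat_step_def)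
    moreover have "?u permutes {1..n}" by (rule permutes_comp_transpose[OF less.prems ij(1,2)])
    ultimately have "bruhat_le n id ?u" by (rule less.hyps)
    with step show ?thesis unfolding bruhat_le_def by (rule rtranclp.rtrancl_into_rtrancl[rotated])
  qed (simp add: bruhat_le_def)
qed

text \<open>A step down puts the smaller value \<open>v j\<close> at \<open>i\<close> and the larger
  value \<open>v i\<close> at \<open>j\<close>. As \<open>i < j\<close>, each bound at the new place
  follows from a bound of \<open>v\<close> at \<open>i\<close> or \<open>j\<close>.\<close>

lemma band_perms_downward_closed:
  assumes "bruhat_le n v w" "w \<in> band_perms n k"
  shows "v \<in> band_perms n k"
  using assms unfolding bruhat_le_def
proof (induction rule: converse_rtranclp_induct)
  case (step u v)
  then have v: "v \<in> band_perms n k" by simp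
  then have perm: "v permutes {1..n}"
    and b: "\<And>i. i \<in> {1..n} \<Longrightarrow> i \<le> v i + k \<and> v i \<le> i + (n - k)"
    by (auto simp: band_perms_def)
  obtain i j where ij: "i \<in> {1..n}" "j \<in> {1..n}" "i < j" "u i < u j" "u permutes {1..n}"
    and vu: "v = u \<circ> Transposition.transpose i j"
    using bruhat_stepE[OF step.hyps(1) perm] .
  have vij: "v i = u j" "v j = u i" using vu by auto
  have "a \<le> u a + k \<and> u a \<le> a + (n - k)" if a: "a \<in> {1..n}" for a
  proof -
    consider "a = i" | "a = j" | "a \<noteq> i" "a \<noteq> j" by blast
    then show ?thesis
    proof cases
      case 3
      then have "v a = u a" using vu by simp
      then show ?thesis using b[OF a] by simp
    qed (use b[OF ij(1)] b[OF ij(2)] vij ij in auto)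
  qed
  with ij(5) show ?case by (simp add: band_perms_def)
qed

text \<open>Raise the first value \<open>v i\<close> that is too small by exchanging it with the first larger
  admissible value to its right, at position \<open>j\<close>. The positions in between only carry values below \<open>v i\<close> or above
  \<open>n - k + i\<close>, so there are few of them and \<open>v i\<close> may be moved to \<open>j\<close>.\<close>

lemma band_perms_step:
  assumes k: "k \<le> n" and w: "w permutes {1..n}"
    and w1: "\<forall>i\<in>{1..k}. w i = n - k + i" and w2: "\<forall>i\<in>{k+1..n}. w i = i - k"
    and v: "v \<in> band_perms n k" and neq: "v \<noteq> w"
  obtains v' where "bruhat_step n v v'" "v' \<in> band_perms n k"
proof -
  have perm: "v permutes {1..n}"
    and b: "\<And>i. i \<in> {1..n} \<Longrightarrow> i \<le> v i + k \<and> v i \<le> i + (n - k)"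
    using v by (auto simp: band_perms_def)
  have inj: "inj v" using perm by (rule permutes_inj)
  from neq obtain i0 where "v i0 \<noteq> w i0" by (auto simp: fun_eq_iff)
  define i where "i = (LEAST i. v i \<noteq> w i)"
  have i: "v i \<noteq> w i" unfolding i_def by (rule LeastI[of "\<lambda>i. v i \<noteq> w i"]) fact
  have min: "v a = w a" if "a < i" for a using not_less_Least[OF that[unfolded i_def]] by simp
  have i_n: "i \<in> {1..n}" using i permutes_not_in[OF perm] permutes_not_in[OF w] by metis
  then have wi_n: "w i \<in> {1..n}" using permutes_in_image[OF w] by simp
  obtain p where p: "v p = w i" using permutes_surj[OF perm] by (metis surjD)
  have p_n: "p \<in> {1..n}" using p wi_n permutes_in_image[OF perm] by metis
  have "p \<noteq> i" using p i by auto
  moreover have "\<not> p < i" using p min[of p] permutes_inj[OF w] by (metis injD less_irrefl)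
  ultimately have ip: "i < p" by simp
  \<comment> \<open>Otherwise the value \<open>i - k\<close> sits in \<open>v\<close> at
    \<open>p > i\<close>, violating the lower bound there.\<close>
  have i_k: "i \<le> k"
  proof (rule ccontr)
    assume "\<not> i \<le> k"
    then have "v p = i - k" "k < i" using w2 i_n p by auto
    then show False using b[OF p_n] ip by simp
  qed
  then have wi: "w i = n - k + i" using w1 i_n by simp
  have vi: "v i < n - k + i" using b[OF i_n] i wi by simp
  define j where "j = (LEAST j. i < j \<and> v i < v j \<and> v j \<le> n - k + i)"
  have ex: "i < p \<and> v i < v p \<and> v p \<le> n - k + i" using ip vi p wi by simp
  have j: "i < j" "v i < v j" "v j \<le> n - k + i"
    using LeastI[of "\<lambda>j. i < j \<and> v i < v j \<and> v j \<le> n - k + i", OF ex] by (auto simp: j_def)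
  have jp: "j \<le> p" unfolding j_def by (rule Least_le) (rule ex)
  have between: "v a < v i \<or> n - k + i < v a" if "i < a" "a < j" for a
  proof -
    have "\<not> (i < a \<and> v i < v a \<and> v a \<le> n - k + i)"
      using not_less_Least that(2) unfolding j_def by blast
    moreover have "v a \<noteq> v i" using inj that by (simp add: inj_eq)
    ultimately show ?thesis using that by linarith
  qed
  have j_n: "j \<in> {1..n}" using jp p_n j i_n by auto
  have "v ` {i<..<j} \<subseteq> {1..<v i} \<union> {n - k + i<..n}"
  proof clarify
    fix a assume a: "a \<in> {i<..<j}" "v a \<notin> {n - k + i<..n}"
    have "v a \<in> {1..n}" using a j_n i_n permutes_in_image[OF perm, of a] by auto
    then show "v a \<in> {1..<v i}" using between[of a] a by auto
  qed
  then have "card (v ` {i<..<j}) \<le> card ({1..<v i} \<union> {n - k + i<..n})"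
    by (rule card_mono[rotated]) simp
  also have "\<dots> \<le> card {1..<v i} + card {n - k + i<..n}" by (rule card_Un_le)
  also have "card (v ` {i<..<j}) = card {i<..<j}"
    by (rule card_image) (rule inj_on_subset[OF inj], simp)
  \<comment> \<open>The values strictly between come from \<open>v i - 1\<close> small and
    \<open>k - i\<close> large ones. Solved for \<open>j\<close> this is
    \<open>j \<le> v i + k\<close>, the lower bound at \<open>j\<close> after the exchange.\<close>
  finally have "j - Suc i \<le> (v i - 1) + (n - (n - k + i))" by simp
  moreover have "v i \<in> {1..n}" using i_n permutes_in_image[OF perm] by simp
  ultimately have jle: "j \<le> v i + k" using i_k k j by auto
  let ?v = "v \<circ> Transposition.transpose i j"
  have "bruhat_step n v ?v" by (rule bruhat_step_transpose[OF i_n j_n j(1,2)])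
  moreover have "a \<le> ?v a + k \<and> ?v a \<le> a + (n - k)" if a: "a \<in> {1..n}" for a
  proof -
    consider "a = i" | "a = j" | "a \<noteq> i" "a \<noteq> j" by blast
    then show ?thesis
    proof cases
      case 3
      then show ?thesis using b[OF a] by simp
    qed (use b[OF i_n] j jle i_k in auto)
  qed
  then have "?v \<in> band_perms n k"
    using permutes_comp_transpose[OF perm i_n j_n] by (simp add: band_perms_def)
  ultimately show thesis by (rule that)
qed

lemma perm_length_le: "perm_length n v \<le> n * n"
proof -
  have "perm_length n v \<le> card ({1..n} \<times> {1..n})"
    unfolding perm_length_def by (rule card_mono) auto
  then show ?thesis by simp
qed

text \<open>Raising inside the band increases the length, which is at most \<open>n * n\<close>, so
  it terminates; it can only stop at \<open>w\<close>.\<close>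

lemma band_perms_bruhat_le:
  assumes k: "k \<le> n" and w: "w permutes {1..n}"
    and w1: "\<forall>i\<in>{1..k}. w i = n - k + i" and w2: "\<forall>i\<in>{k+1..n}. w i = i - k"
    and v: "v \<in> band_perms n k"
  shows "bruhat_le n v w"
  using v
proof (induction "n * n - perm_length n v" arbitrary: v rule: less_induct)
  case less
  show ?case
  proof (cases "v = w")
    case False
    obtain v' where v': "bruhat_step n v v'" "v' \<in> band_perms n k"
      using band_perms_step[OF k w w1 w2 less.prems False] .
    have "perm_length n v < perm_length n v'" using v'(1) by (auto simp: bruhat_step_def)
    then have "n * n - perm_length n v' < n * n - perm_length n v"
      using perm_length_le[of n v'] by linarith
    then have "bruhat_le n v' w" using v'(2) by (rule less.hyps)
    with v'(1) show ?thesis unfolding bruhat_le_def by (rule converse_rtranclp_into_rtranclp)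
  qed (simp add: bruhat_le_def)
qed

lemma bruhat_interval_eq_band_perms:
  assumes k: "k \<le> n" and w: "w permutes {1..n}"
    and w1: "\<forall>i\<in>{1..k}. w i = n - k + i" and w2: "\<forall>i\<in>{k+1..n}. w i = i - k"
  shows "bruhat_interval n id w = band_perms n k"
proof -
  have "i \<le> w i + k \<and> w i \<le> i + (n - k)" if "i \<in> {1..n}" for i
    using that w1 w2 by (cases "i \<le> k") auto
  then have "w \<in> band_perms n k" using w by (simp add: band_perms_def)
  then have "v \<in> band_perms n k" if "bruhat_le n v w" for v
    using band_perms_downward_closed that by blast
  moreover have "bruhat_le n v w" if "v \<in> band_perms n k" for v
    by (rule band_perms_bruhat_le[OF assms that])
  moreover have "v permutes {1..n}" if "v \<in> band_perms n k" for v
    using that by (simp add: band_perms_def)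
  ultimately show ?thesis
    unfolding bruhat_interval_def sym_group_def using bruhat_le_id by auto
qed

section \<open>Minimal coset representatives\<close>

text \<open>At a descent, right multiplication by \<open>adj_transp i\<close> stays in the coset and
  shortens \<open>v\<close>.\<close>

lemma min_left_coset_reps_ascent:
  assumes v: "v \<in> min_left_coset_reps n (adj_transp ` S)" and i: "i \<in> S" "1 \<le> i" "i < n"
  shows "v i < v (i + 1)"
proof (rule ccontr)
  assume neg: "\<not> v i < v (i + 1)"
  have perm: "v permutes {1..n}" using v by (simp add: min_left_coset_reps_def sym_group_def)
  have i_n: "i \<in> {1..n}" "i + 1 \<in> {1..n}" "i < i + 1" using i by auto
  let ?u = "v \<circ> adj_transp i"
  have "adj_transp i \<in> generate (sym_group n) (adj_transp ` S)"
    using i by (intro generate.incl) simp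
  then have "?u \<in> v <#\<^bsub>sym_group n\<^esub> generate (sym_group n) (adj_transp ` S)"
    by (auto simp: l_coset_def sym_group_def)
  then have "perm_length n v \<le> perm_length n ?u"
    using v by (simp add: min_left_coset_reps_def)
  moreover have "v i \<noteq> v (i + 1)" using permutes_inj[OF perm] by (simp add: inj_eq)
  with neg have "?u i < ?u (i + 1)" by (simp add: adj_transp_def)
  from perm_length_transpose_less[OF i_n this] have "perm_length n ?u < perm_length n v"
    by (simp only: adj_transp_def transpose_comp_cancel)
  ultimately show False by simp
qed

text \<open>This yields the maximality of \<open>w\<close>. A representative increases on
  \<open>{1..k}\<close> and on \<open>{k+1..n}\<close>, so
  \<open>v i + (k - i) \<le> v k \<le> n\<close> on the first block and
  \<open>i - k \<le> v i\<close> on the second.\<close>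

lemma min_left_coset_reps_subset_band_perms:
  assumes "k \<le> n"
  shows "min_left_coset_reps n (adj_transp ` ({1..n-1} - {k})) \<subseteq> band_perms n k"
proof
  fix v assume v: "v \<in> min_left_coset_reps n (adj_transp ` ({1..n-1} - {k}))"
  have perm: "v permutes {1..n}" using v by (simp add: min_left_coset_reps_def sym_group_def)
  have asc: "v i < v (i + 1)" if "1 \<le> i" "i < n" "i \<noteq> k" for i
    using min_left_coset_reps_ascent[OF v, of i] that by auto
  have im: "v i \<in> {1..n}" if "i \<in> {1..n}" for i using that permutes_in_image[OF perm] by simp
  have up: "v i + d \<le> v (i + d)" if "1 \<le> i" "i + d \<le> n" "k < i \<or> i + d \<le> k" for i d
    using that
  proof (induction d)
    case (Suc d)
    then show ?case using asc[of "i + d"] by auto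
  qed simp
  have "i \<le> v i + k \<and> v i \<le> i + (n - k)" if i: "i \<in> {1..n}" for i
  proof (cases "i \<le> k")
    case True
    then show ?thesis using up[of i "k - i"] im[of k] i assms by auto
  next
    case False
    then show ?thesis using up[of "k + 1" "i - (k + 1)"] im[of "k + 1"] im[of i] i by auto
  qed
  then show "v \<in> band_perms n k" using perm by (simp add: band_perms_def)
qed

text \<open>Only the excluded generator \<open>adj_transp k\<close> moves points across the cut
  between \<open>k\<close> and \<open>k + 1\<close>; the other generators are involutions respecting
  it.\<close>

lemma generate_adj_transp_preserves:
  assumes "h \<in> generate (sym_group n) (adj_transp ` ({1..n-1} - {k}))"
  shows "h permutes {1..n} \<and> (\<forall>i. h i \<le> k \<longleftrightarrow> i \<le> k)"
proof -
  have gen: "h permutes {1..n} \<and> (\<forall>i. h i \<le> k \<longleftrightarrow> i \<le> k)"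
    if h: "h \<in> adj_transp ` ({1..n-1} - {k})" for h
  proof -
    obtain i where i: "i \<in> {1..n-1}" "i \<noteq> k" "h = adj_transp i" using h by blast
    have "h permutes {1..n}"
      unfolding i(3) adj_transp_def using i(1) by (intro permutes_swap_id) auto
    moreover have "\<forall>a. h a \<le> k \<longleftrightarrow> a \<le> k"
      using i(2) by (auto simp: i(3) adj_transp_def transpose_def)
    ultimately show ?thesis by blast
  qed
  from assms show ?thesis
  proof (induction rule: generate.induct)
    case one
    then show ?case using permutes_id[of "{1..n}"] by (simp add: sym_group_one id_def)
  next
    case (incl h)
    then show ?case by (rule gen)
  next
    case (inv h)
    then obtain i where i: "h = adj_transp i" by blast
    have "h permutes {1..n}" using gen[OF inv] by blast
    then have "inv\<^bsub>sym_group n\<^esub> h = Hilbert_Choice.inv h"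
      by (intro sym_group_inv_equality) (simp only: sym_group_carrier)
    also have "\<dots> = h" unfolding i adj_transp_def by simp
    finally show ?case using gen[OF inv] by simp
  next
    case (eng h1 h2)
    then show ?case
      unfolding sym_group_mult using permutes_compose[of h2 "{1..n}" h1] by (simp add: o_def)
  qed
qed

text \<open>\<open>w\<close> increases on each block and inverts every pair straddling the cut. As
  \<open>h\<close> preserves the blocks, every inversion of \<open>w\<close> is one of
  \<open>w \<circ> h\<close>.\<close>

lemma mem_min_left_coset_reps:
  assumes w: "w permutes {1..n}"
    and w1: "\<forall>i\<in>{1..k}. w i = n - k + i" and w2: "\<forall>i\<in>{k+1..n}. w i = i - k"
  shows "w \<in> min_left_coset_reps n (adj_transp ` ({1..n-1} - {k}))"
proof -
  let ?I = "\<lambda>f :: nat \<Rightarrow> nat. {(a, b). a \<in> {1..n} \<and> b \<in> {1..n} \<and> a < b \<and> f a > f b}"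
  have "perm_length n w \<le> perm_length n (w \<circ> h)"
    if "h \<in> generate (sym_group n) (adj_transp ` ({1..n-1} - {k}))" for h
  proof -
    have h: "h permutes {1..n}" "\<And>i. h i \<le> k \<longleftrightarrow> i \<le> k"
      using generate_adj_transp_preserves[OF that] by auto
    have "(a, b) \<in> ?I (w \<circ> h)" if "(a, b) \<in> ?I w" for a b
    proof -
      have ab: "a \<in> {1..n}" "b \<in> {1..n}" "a < b" "w b < w a" using that by auto
      have "a \<le> k" "k < b"
      proof -
        show "a \<le> k"
        proof (rule ccontr)
          assume "\<not> a \<le> k"
          then show False using w2 ab by auto
        qed
        show "k < b"
        proof (rule ccontr)
          assume "\<not> k < b"
          then show False using w1 ab by auto
        qed
      qed
      then have "h a \<in> {1..k}" "h b \<in> {k+1..n}"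
        using h(2)[of a] h(2)[of b] ab permutes_in_image[OF h(1), of a] permutes_in_image[OF h(1), of b]
        by auto
      then have "w (h b) < w (h a)" using w1 w2 by auto
      then show ?thesis using ab by simp
    qed
    then have "?I w \<subseteq> ?I (w \<circ> h)" by (rule subrelI)
    moreover have "finite (?I (w \<circ> h))"
      by (rule finite_subset[of _ "{1..n} \<times> {1..n}"]) auto
    ultimately show ?thesis unfolding perm_length_def by (intro card_mono)
  qed
  then show ?thesis
    using w by (auto simp: min_left_coset_reps_def l_coset_def sym_group_def)
qed

text \<open>Moves the integer Poincare polynomial into the fraction field, where
  \<open>1 / q\<close> exists.\<close>

lemma to_fract_monom_1: "to_fract (monom 1 l :: int poly) = to_fract [:0, 1:] ^ l"
proof (induction l)
  case (Suc l)
  have "monom (1::int) (Suc l) = [:0, 1:] * monom 1 l" by (simp add: monom_Suc)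
  then show ?case by (simp only: to_fract_mult Suc.IH power_Suc)
qed simp

theorem theorem3p3:
  fixes n k :: nat and w :: "nat \<Rightarrow> nat" and q :: "int poly fract"
  assumes "1 \<le> k" and "k \<le> n - 1"
    and "w \<in> carrier (sym_group n)"
    and "\<forall>i\<in>{1..k}. w i = n - k + i"
    and "\<forall>i\<in>{k+1..n}. w i = i - k"
    and "q = to_fract [:0, 1:]"
  shows "w \<in> min_left_coset_reps n (adj_transp ` ({1..n-1} - {k})) \<and>
    (\<forall>v \<in> min_left_coset_reps n (adj_transp ` ({1..n-1} - {k})). bruhat_le n v w) \<and>
    to_fract (poincare_poly n id w) =
      q ^ ((n - k) * k) *
      (\<Sum>i=0..k. q_stirling (1 / q) (k + 1) (i + 1) * q_stirling (1 / q) (n - k + 1) (i + 1) *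
                 (q_fact q i)\<^sup>2 * q ^ i)"
proof (intro conjI ballI)
  have k: "k \<le> n" using assms(2) by simp
  have w: "w permutes {1..n}" using assms(3) by (simp add: sym_group_def)
  note w12 = assms(4,5)
  show "w \<in> min_left_coset_reps n (adj_transp ` ({1..n-1} - {k}))"
    by (rule mem_min_left_coset_reps[OF w w12])
  show "bruhat_le n v w" if "v \<in> min_left_coset_reps n (adj_transp ` ({1..n-1} - {k}))" for v
    using band_perms_bruhat_le[OF k w w12] min_left_coset_reps_subset_band_perms[OF k] that by blast
  have "q \<noteq> 0" unfolding assms(6) by simp
  have "to_fract (poincare_poly n id w) = (\<Sum>v\<in>band_perms n k. q ^ perm_length n v)"
    unfolding poincare_poly_def bruhat_interval_eq_band_perms[OF k w w12] assms(6)
    by (simp only: to_fract_sum to_fract_monom_1)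
  also have "\<dots> = (\<Sum>xs\<in>band_words (n - k) k. q ^ list_inv xs)"
    by (rule sum_band_perms[OF k])
  also have "\<dots> = q ^ ((n - k) * k) *
      (\<Sum>i=0..k. q_stirling (1 / q) (k + 1) (i + 1) * q_stirling (1 / q) (n - k + 1) (i + 1) *
                 (q_fact q i)\<^sup>2 * q ^ i)"
    by (rule sum_band_words_q_stirling[OF \<open>q \<noteq> 0\<close>])
  finally show "to_fract (poincare_poly n id w) = q ^ ((n - k) * k) *
      (\<Sum>i=0..k. q_stirling (1 / q) (k + 1) (i + 1) * q_stirling (1 / q) (n - k + 1) (i + 1) *
                 (q_fact q i)\<^sup>2 * q ^ i)" .
qed

end
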